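(* Let $Q_1,\dots,Q_r\in\mathbb{R}^{m\times m}$ be symmetric matrices, let $q_i(z)=z^\top Q_i z$, let $C=\sum_{i=1}^r\|Q_i\|_F^2$ and $B=C+1$, and define the homogeneous quartic $p(z)=B\,(\|z\|^2)^2-\sum_{i=1}^r q_i(z)^2$. Then $\max_{\|z\|=1}p(z)=B$ if and only if there exists $z\in S^{m-1}$ with $q_i(z)=0$ for all $i=1,\dots,r$.
   Context: $\|\cdot\|$ is the Euclidean norm, $S^{m-1}=\{z\in\mathbb{R}^m:\|z\|=1\}$, and $\|Q\|_F=\sqrt{\sum_{i,j}Q_{ij}^2}$ is the Frobenius norm. *)

theory Defs
  imports "HOL-Analysis.Analysis"
begin

definition frobenius_norm :: "real^'n^'m \<Rightarrow> real" where
  "frobenius_norm A = sqrt (\<Sum>i\<in>UNIV. \<Sum>j\<in>UNIV. (A $ i $ j)\<^sup>2)"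

definition quad_form :: "real^'m^'m \<Rightarrow> real^'m \<Rightarrow> real" where
  "quad_form A z = z \<bullet> (A *v z)"

definition const_C :: "nat \<Rightarrow> (nat \<Rightarrow> real^'m^'m) \<Rightarrow> real" where
  "const_C r Q = (\<Sum>i=1..r. (frobenius_norm (Q i))\<^sup>2)"

definition const_B :: "nat \<Rightarrow> (nat \<Rightarrow> real^'m^'m) \<Rightarrow> real" where
  "const_B r Q = const_C r Q + 1"

definition quartic :: "nat \<Rightarrow> (nat \<Rightarrow> real^'m^'m) \<Rightarrow> real^'m \<Rightarrow> real" where
  "quartic r Q z = const_B r Q * ((norm z)\<^sup>2)\<^sup>2 - (\<Sum>i=1..r. (quad_form (Q i) z)\<^sup>2)"

text \<open>The attained maximum of \<open>f\<close> on \<open>S\<close>, i.e. the greatest element of the image. It is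
  meaningful only when such an element exists, for instance for continuous \<open>f\<close> and compact
  nonempty \<open>S\<close>; \<^const>\<open>Max\<close> is not usable because it is restricted to finite sets.\<close>

definition max_on :: "'a set \<Rightarrow> ('a \<Rightarrow> real) \<Rightarrow> real" where
  "max_on S f = (GREATEST v. v \<in> f ` S)"

end

theory Submission
  imports Defs
begin

text \<open>On the unit sphere the quartic is B minus a sum of squares
  (\<open>quartic_on_sphere\<close>). It is therefore at most B there, with equality exactly at the
  common zeros of the forms. So the maximum is B precisely when the bound B is attained; that a
  maximum is attained at all follows from compactness and continuity
  (\<open>max_on_attained\<close>, \<open>continuous_on_quartic\<close>).\<close>

lemma max_on_eqI:
  assumes "z \<in> S" "\<And>w. w \<in> S \<Longrightarrow> f w \<le> f z"
  shows "max_on S f = f z"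
  unfolding max_on_def using assms by (intro Greatest_equality) auto

text \<open>\<open>GREATEST\<close> carries information only if the image has a greatest element.
  Compactness provides a maximiser, so an equation about \<open>max_on\<close> becomes one about a
  point of \<open>S\<close>.\<close>

lemma max_on_attained:
  fixes S :: "'a::topological_space set" and f :: "'a \<Rightarrow> real"
  assumes "compact S" "S \<noteq> {}" "continuous_on S f"
  obtains z where "z \<in> S" "max_on S f = f z"
  using continuous_attains_sup[OF assms] max_on_eqI by metis

lemma continuous_on_quartic:
  fixes S :: "(real^'m) set"
  shows "continuous_on S (quartic r Q)"
proof -
  have "continuous_on S (\<lambda>z. A *v z)" for A :: "real^'m^'m"
    by (intro linear_continuous_on linear_conv_bounded_linear[THEN iffD1]) simp
  then show ?thesis
    unfolding quartic_def quad_form_def by (intro continuous_intros)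
qed

lemma quartic_on_sphere:
  assumes "z \<in> sphere 0 1"
  shows "quartic r Q z = const_B r Q - (\<Sum>i=1..r. (quad_form (Q i) z)\<^sup>2)"
  using assms by (simp add: quartic_def)

theorem mainTheorem6:
  fixes Q :: "nat \<Rightarrow> real^'m^'m" and r :: nat
  assumes "\<And>i. i \<in> {1..r} \<Longrightarrow> transpose (Q i) = Q i"
  shows "max_on (sphere 0 1) (quartic r Q) = const_B r Q \<longleftrightarrow>
    (\<exists>z\<in>sphere (0 :: real^'m) 1. \<forall>i\<in>{1..r}. quad_form (Q i) z = 0)"
proof
  assume max: "max_on (sphere 0 1) (quartic r Q) = const_B r Q"
  \<comment> \<open>Index types are inhabited, so the dimension is at least 1 and unit vectors
    exist.\<close>
  have "sphere (0 :: real^'m) 1 \<noteq> {}"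
    by simp
  then obtain z where z: "z \<in> sphere 0 1" "max_on (sphere 0 1) (quartic r Q) = quartic r Q z"
    using max_on_attained[OF compact_sphere _ continuous_on_quartic] by blast
  \<comment> \<open>At the maximiser B cancels on both sides; a zero sum of squares forces every
    form to vanish.\<close>
  then have "(\<Sum>i=1..r. (quad_form (Q i) z)\<^sup>2) = 0"
    using max quartic_on_sphere[OF z(1)] by simp
  then have "\<forall>i\<in>{1..r}. quad_form (Q i) z = 0"
    by (subst (asm) sum_nonneg_eq_0_iff) auto
  with z(1) show "\<exists>z\<in>sphere 0 1. \<forall>i\<in>{1..r}. quad_form (Q i) z = 0"
    by blast
next
  assume "\<exists>z\<in>sphere (0 :: real^'m) 1. \<forall>i\<in>{1..r}. quad_form (Q i) z = 0"
  then obtain z :: "real^'m" where z: "z \<in> sphere 0 1" "\<forall>i\<in>{1..r}. quad_form (Q i) z = 0"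
    by blast
  then have B: "quartic r Q z = const_B r Q"
    using quartic_on_sphere[OF z(1)] by simp
  \<comment> \<open>Subtracting squares only lowers B, and at \<open>z\<close> nothing is
    subtracted, so \<open>z\<close> is a maximiser.\<close>
  have "quartic r Q w \<le> quartic r Q z" if "w \<in> sphere 0 1" for w
    unfolding B quartic_on_sphere[OF that] by (simp add: sum_nonneg)
  then show "max_on (sphere 0 1) (quartic r Q) = const_B r Q"
    using max_on_eqI[OF z(1)] B by metis
qed

end
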